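(* Let $\mathsf U\subset\mathbb R^n$ be a neighborhood of the origin and let $F_1,\dots,F_m:\mathsf U\to\mathbb R$, $m\le n$, be analytic functions with $F_u(0)=0$ for $u=1,\dots,m$. Suppose the family $\{F_1,\dots,F_m\}$ splits into subfamilies $\mathcal F_a=\{F_{a,1},\dots,F_{a,m_a}\}$, $a=1,\dots,L$, such that: (A) in each subfamily $\mathcal F_a$ there is exactly one (up to proportionality) linear dependency $\lambda_a$ between the linear parts of the functions of the subfamily, and this dependency is convex; (B) the set of variables $\{x^1,\dots,x^n\}$ is a disjoint union of sets $\mathcal X_1,\dots,\mathcal X_L$ and $\mathcal Y$ such that, for each $a=1,\dots,L$, the linear parts of the functions from $\mathcal F_a$ depend only on the variables from $\mathcal X_a$; (C) the family of quadratic forms $\mathfrak q[\lambda_a]$, $a=1,\dots,L$, is negatively defined on the subspace $E$. Then the origin is a strict local maximum of the function $\mathsf F(x)=\min\{F_1(x),\dots,F_m(x)\}$.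
   Context: Write $F_u(x)=\sum_j l_{uj}x^j+\sum_{j,k}q_{ujk}x^jx^k+o(2)$ for the Taylor expansion at the origin, where $o(2)$ denotes terms of order higher than two; $l_u(\xi)=\sum_j l_{uj}\xi^j$ is the linear part and $q_u(\xi)=\sum_{j,k}q_{ujk}\xi^j\xi^k$ the quadratic part, viewed as forms on the tangent space $T_0\mathbb R^n$ with coordinates $\xi^j=dx^j$. Set $E=\bigcap_{u=1}^m\ker l_u\subset T_0\mathbb R^n$. A linear dependency between the linear parts of a set of the functions is a nonzero tuple $\mu=(\mu^u)$ with $\sum_u\mu^u l_{uj}=0$ for all $j=1,\dots,n$; it is called convex if (after rescaling) all its coefficients $\mu^u$ are strictly positive (they may be normalized to sum to $1$). For a dependency $\lambda_a$ of the subfamily $\mathcal F_a$, the sum runs over the functions in $\mathcal F_a$ (coefficients for the other functions are zero), and $\lambda_a$ is taken with positive coefficients. For a dependency $\mu$, $\mathfrak q[\mu]$ is the quadratic form on $E$ given by $\mathfrak q[\mu](\xi)=\sum_{u}\mu^u q_u(\xi)$, $\xi\in E$. A family $\{\mathfrak Q_1,\dots,\mathfrak Q_L\}$ of quadratic forms on a real vector space $\mathbb V$ is called positively defined if the system of inequalities $\mathfrak Q_a(x)\le 0$, $a=1,\dots,L$, admits only the trivial solution $x=0$; it is called negatively defined if $\{-\mathfrak Q_1,\dots,-\mathfrak Q_L\}$ is positively defined, i.e. if $\mathfrak Q_a(x)\ge0$ for all $a$ implies $x=0$. *)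

theory Defs
  imports "HOL-Analysis.Analysis"
begin

definition multi_power :: "real ^ 'n \<Rightarrow> ('n::finite \<Rightarrow> nat) \<Rightarrow> real" where
  "multi_power x \<alpha> = (\<Prod>j\<in>UNIV. (x $ j) ^ \<alpha> j)"

(* Multi-indices are functions 'n => nat. has_sum is unconditional, hence absolute, convergence. *)
definition has_power_series_at ::
    "(real ^ 'n \<Rightarrow> real) \<Rightarrow> (('n::finite \<Rightarrow> nat) \<Rightarrow> real) \<Rightarrow> real ^ 'n \<Rightarrow> bool" where
  "has_power_series_at f c a \<longleftrightarrow>
     (\<exists>r>0. \<forall>x\<in>ball a r. ((\<lambda>\<alpha>. c \<alpha> * multi_power (x - a) \<alpha>) has_sum f x) UNIV)"

definition real_analytic_on :: "(real ^ 'n::finite \<Rightarrow> real) \<Rightarrow> (real ^ 'n) set \<Rightarrow> bool" where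
  "real_analytic_on f U \<longleftrightarrow> (\<forall>a\<in>U. \<exists>c. has_power_series_at f c a)"

definition lin_form :: "('n::finite \<Rightarrow> real) \<Rightarrow> real ^ 'n \<Rightarrow> real" where
  "lin_form l \<xi> = (\<Sum>j\<in>UNIV. l j * \<xi> $ j)"

definition quad_form :: "('n::finite \<Rightarrow> 'n \<Rightarrow> real) \<Rightarrow> real ^ 'n \<Rightarrow> real" where
  "quad_form q \<xi> = (\<Sum>j\<in>UNIV. \<Sum>k\<in>UNIV. q j k * \<xi> $ j * \<xi> $ k)"

(* Near the origin, f is the sum of its linear part, its quadratic part and a power series all of
   whose terms have order higher than two. For f analytic at 0 with f 0 = 0 such l and q exist, l is
   unique, and q is unique as a quadratic form (the coefficients q j k need not be symmetric). *)
definition taylor2 ::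
    "(real ^ 'n::finite \<Rightarrow> real) \<Rightarrow> ('n \<Rightarrow> real) \<Rightarrow> ('n \<Rightarrow> 'n \<Rightarrow> real) \<Rightarrow> bool" where
  "taylor2 f l q \<longleftrightarrow>
     (\<exists>c. (\<forall>\<alpha>. (\<Sum>j\<in>UNIV. \<alpha> j) \<le> 2 \<longrightarrow> c \<alpha> = 0) \<and>
          has_power_series_at (\<lambda>x. f x - lin_form l x - quad_form q x) c 0)"

(* A dependency of the subfamily S, extended by zero to the functions outside S. *)
definition lin_dependency ::
    "(nat \<Rightarrow> 'n::finite \<Rightarrow> real) \<Rightarrow> nat set \<Rightarrow> (nat \<Rightarrow> real) \<Rightarrow> bool" where
  "lin_dependency l S \<mu> \<longleftrightarrow>
     (\<forall>u. u \<notin> S \<longrightarrow> \<mu> u = 0) \<and> (\<exists>u\<in>S. \<mu> u \<noteq> 0) \<and> (\<forall>j. (\<Sum>u\<in>S. \<mu> u * l u j) = 0)"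

definition unique_lin_dependency ::
    "(nat \<Rightarrow> 'n::finite \<Rightarrow> real) \<Rightarrow> nat set \<Rightarrow> (nat \<Rightarrow> real) \<Rightarrow> bool" where
  "unique_lin_dependency l S \<mu> \<longleftrightarrow>
     lin_dependency l S \<mu> \<and> (\<forall>\<nu>. lin_dependency l S \<nu> \<longrightarrow> (\<exists>t. \<forall>u. \<nu> u = t * \<mu> u))"

definition common_kernel :: "nat \<Rightarrow> (nat \<Rightarrow> 'n::finite \<Rightarrow> real) \<Rightarrow> (real ^ 'n) set" where
  "common_kernel m l = (\<Inter>u\<in>{1..m}. {\<xi>. lin_form (l u) \<xi> = 0})"

definition dep_quad_form ::
    "nat \<Rightarrow> (nat \<Rightarrow> 'n::finite \<Rightarrow> 'n \<Rightarrow> real) \<Rightarrow> (nat \<Rightarrow> real) \<Rightarrow> real ^ 'n \<Rightarrow> real" where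
  "dep_quad_form m q \<mu> \<xi> = (\<Sum>u\<in>{1..m}. \<mu> u * quad_form (q u) \<xi>)"

definition positively_defined_on ::
    "'v::real_vector set \<Rightarrow> nat \<Rightarrow> (nat \<Rightarrow> 'v \<Rightarrow> real) \<Rightarrow> bool" where
  "positively_defined_on V L Q \<longleftrightarrow> (\<forall>x\<in>V. (\<forall>a\<in>{1..L}. Q a x \<le> 0) \<longrightarrow> x = 0)"

definition negatively_defined_on ::
    "'v::real_vector set \<Rightarrow> nat \<Rightarrow> (nat \<Rightarrow> 'v \<Rightarrow> real) \<Rightarrow> bool" where
  "negatively_defined_on V L Q \<longleftrightarrow> positively_defined_on V L (\<lambda>a x. - Q a x)"

definition strict_local_max ::
    "('a::topological_space \<Rightarrow> real) \<Rightarrow> 'a set \<Rightarrow> 'a \<Rightarrow> bool" where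
  "strict_local_max f U p \<longleftrightarrow> p \<in> U \<and> (\<forall>\<^sub>F x in at p within U. f x < f p)"

end

theory Submission
  imports Defs
begin

text \<open>
  The proof is a compactness argument on directions. If the origin is not a strict local maximum of
  the minimum, there are points \<open>x\<^sub>n \<noteq> 0\<close> tending to \<open>0\<close> at which every \<open>F u\<close> is nonnegative, and after
  passing to a subsequence the directions \<open>\<xi>\<^sub>n = x\<^sub>n / \<parallel>x\<^sub>n\<parallel>\<close> converge to a unit vector \<open>\<xi>\<close>.

  Dividing by \<open>\<parallel>x\<^sub>n\<parallel>\<close> and passing to the limit gives \<open>lin_form (l u) \<xi> \<ge> 0\<close> for all \<open>u\<close>. Within each
  subfamily these numbers have a vanishing combination with strictly positive coefficients, so all of
  them are zero and \<open>\<xi>\<close> lies in the common kernel. In the combination of the \<open>F u\<close> with the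
  coefficients of the dependency the linear parts cancel identically, not just at \<open>\<xi>\<close>, so dividing it
  by \<open>\<parallel>x\<^sub>n\<parallel>\<^sup>2\<close> and passing to the limit leaves the quadratic form of the dependency at \<open>\<xi>\<close>, which is
  therefore nonnegative. As the family of these forms is negatively defined on the common kernel,
  \<open>\<xi> = 0\<close>, contradicting \<open>\<parallel>\<xi>\<parallel> = 1\<close>.

  The estimate behind both limits is \<open>taylor2_remainder\<close>: the Taylor remainder is negligible against
  \<open>\<parallel>x\<parallel>\<^sup>2\<close>. It is bounded by comparing the series at \<open>x\<close> with the absolutely convergent series at the
  single point \<open>(s, \<dots>, s)\<close>, whose coordinates dominate those of all \<open>x\<close> in the ball of radius \<open>s\<close>.
\<close>

section \<open>Power series without low order terms\<close>

lemma multi_power_const: "multi_power (\<chi> j. s) \<alpha> = s ^ (\<Sum>j\<in>UNIV. \<alpha> j)"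
  by (simp add: multi_power_def power_sum)

lemma abs_multi_power_le: "\<bar>multi_power x \<alpha>\<bar> \<le> norm x ^ (\<Sum>j\<in>UNIV. \<alpha> j)"
proof -
  have "\<bar>multi_power x \<alpha>\<bar> = (\<Prod>j\<in>UNIV. \<bar>x $ j\<bar> ^ \<alpha> j)"
    by (simp add: multi_power_def abs_prod power_abs)
  also have "\<dots> \<le> (\<Prod>j\<in>UNIV. norm x ^ \<alpha> j)"
    by (intro prod_mono conjI power_mono component_le_norm_cart) auto
  finally show ?thesis by (simp add: power_sum)
qed

text \<open>
  A term of degree \<open>d \<ge> k\<close> is at most \<open>(\<parallel>x\<parallel> / s)\<^sup>d \<le> (\<parallel>x\<parallel> / s)\<^sup>k\<close> times the absolute value of the
  corresponding term at the point with all coordinates \<open>s\<close>, and the latter values are summable because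
  unconditional convergence of real series is absolute.
\<close>

lemma power_series_order_bound:
  assumes ps: "has_power_series_at f c 0"
    and low: "\<And>\<alpha>. (\<Sum>j\<in>UNIV. \<alpha> j) < k \<Longrightarrow> c \<alpha> = 0"
  shows "\<exists>s>0. \<exists>K. \<forall>x. norm x \<le> s \<longrightarrow> \<bar>f x\<bar> \<le> K * norm x ^ k"
proof -
  obtain r where r: "r > 0" 
    and hs: "\<And>x. x \<in> ball 0 r \<Longrightarrow> ((\<lambda>\<alpha>. c \<alpha> * multi_power x \<alpha>) has_sum f x) UNIV"
    using ps unfolding has_power_series_at_def by auto
  \<comment> \<open>\<open>s\<close> is small enough for the corner \<open>(s, \<dots>, s) = s *\<^sub>R w\<close> of the cube to lie in the ball of
    convergence; this handles all points of norm at most \<open>s\<close>.\<close>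
  define w :: "real ^ 'a" where "w = (\<chi> j. 1)"
  have w: "norm w > 0" by (simp add: w_def vec_eq_iff)
  define s where "s = r / (2 * norm w)"
  have s: "s > 0" using r w by (simp add: s_def)
  have sw: "(\<chi> j. s) = s *\<^sub>R w" by (simp add: w_def vec_eq_iff)
  have corner: "(\<chi> j. s) \<in> ball (0 :: real ^ 'a) r"
    using r w unfolding sw by (simp add: s_def)
  have nw: "1 \<le> norm w"
    using component_le_norm_cart[of w] by (simp add: w_def)
  have small: "x \<in> ball 0 r" if "norm x \<le> s" for x :: "real ^ 'a"
  proof -
    have "r / (2 * norm w) < r"
      using r nw w by (simp add: divide_less_eq)
    then show ?thesis using that by (simp add: s_def)
  qed
  define K where "K = (\<Sum>\<^sub>\<infinity>\<alpha>. \<bar>c \<alpha> * multi_power (\<chi> j. s) \<alpha>\<bar>)"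
  have K: "((\<lambda>\<alpha>. \<bar>c \<alpha> * multi_power (\<chi> j. s) \<alpha>\<bar>) has_sum K) UNIV"
    using hs[OF corner, THEN has_sum_imp_summable,
        THEN summable_on_iff_abs_summable_on_real[THEN iffD1]]
    unfolding K_def real_norm_def by (rule has_sum_infsum)
  have "\<bar>f x\<bar> \<le> K / s ^ k * norm x ^ k" if x: "norm x \<le> s" for x
  proof -
    have term_le: "norm (c \<alpha> * multi_power x \<alpha>)
        \<le> \<bar>c \<alpha> * multi_power (\<chi> j. s) \<alpha>\<bar> * (norm x / s) ^ k" for \<alpha>
    proof (cases "(\<Sum>j\<in>UNIV. \<alpha> j) < k")
      case True
      then show ?thesis by (simp add: low)
    next
      case False
      define d where "d = (\<Sum>j\<in>UNIV. \<alpha> j)"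
      have "\<bar>multi_power x \<alpha>\<bar> \<le> norm x ^ d"
        unfolding d_def by (rule abs_multi_power_le)
      also have "\<dots> = s ^ d * (norm x / s) ^ d"
        using s by (simp add: power_divide)
      also have "\<dots> \<le> s ^ d * (norm x / s) ^ k"
        using s x False by (intro mult_left_mono power_decreasing) (auto simp: d_def)
      finally have "\<bar>c \<alpha>\<bar> * \<bar>multi_power x \<alpha>\<bar> \<le> \<bar>c \<alpha>\<bar> * (s ^ d * (norm x / s) ^ k)"
        by (rule mult_left_mono) simp
      then show ?thesis
        using s by (simp add: abs_mult multi_power_const d_def mult.assoc)
    qed
    have "norm (f x) \<le> K * (norm x / s) ^ k"
      by (rule norm_infsum_le[OF hs[OF small[OF x]] has_sum_cmult_left[OF K] term_le])
    then show ?thesis by (simp add: power_divide)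
  qed
  with s show ?thesis by blast
qed

lemma taylor2_remainder:
  assumes "taylor2 f l q"
  shows "((\<lambda>x. (f x - lin_form l x - quad_form q x) / (norm x)\<^sup>2) \<longlongrightarrow> 0) (at 0)"
proof -
  let ?R = "\<lambda>x. f x - lin_form l x - quad_form q x"
  obtain c where low: "\<And>\<alpha>. (\<Sum>j\<in>UNIV. \<alpha> j) < 3 \<Longrightarrow> c \<alpha> = 0"
    and ps: "has_power_series_at ?R c 0"
    using assms unfolding taylor2_def by (metis less_Suc_eq_le numeral_2_eq_2 numeral_3_eq_3)
  obtain s K where s: "s > 0" and K: "\<And>x. norm x \<le> s \<Longrightarrow> \<bar>?R x\<bar> \<le> K * norm x ^ 3"
    using power_series_order_bound[of ?R c 3] ps low by blast
  have "\<forall>\<^sub>F x in at (0 :: real ^ 'a). x \<noteq> 0 \<and> norm x < s"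
    unfolding eventually_at using s by auto
  then have ev: "\<forall>\<^sub>F x in at 0. norm (?R x / (norm x)\<^sup>2) \<le> K * norm x"
  proof eventually_elim
    case (elim x)
    then have "\<bar>?R x\<bar> / (norm x)\<^sup>2 \<le> K * norm x ^ 3 / (norm x)\<^sup>2"
      by (intro divide_right_mono K) auto
    also have "\<dots> = K * norm x"
      using elim by (simp add: power2_eq_square power3_eq_cube)
    finally show ?case by simp
  qed
  have "((\<lambda>x :: real ^ 'a. K * norm x) \<longlongrightarrow> K * norm (0 :: real ^ 'a)) (at 0)"
    by (intro tendsto_intros)
  then show ?thesis
    using Lim_null_comparison[OF ev] by simp
qed

section \<open>Limits along a sequence with a limiting direction\<close>

lemma lin_form_scaleR: "lin_form l (t *\<^sub>R x) = t * lin_form l x"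
  by (simp add: lin_form_def sum_distrib_left mult_ac)

lemma quad_form_scaleR: "quad_form q (t *\<^sub>R x) = t\<^sup>2 * quad_form q x"
  by (simp add: quad_form_def sum_distrib_left mult_ac power2_eq_square)

lemma tendsto_lin_form: "(g \<longlongrightarrow> x) G \<Longrightarrow> ((\<lambda>n. lin_form l (g n)) \<longlongrightarrow> lin_form l x) G"
  unfolding lin_form_def by (intro tendsto_intros)

lemma tendsto_quad_form: "(g \<longlongrightarrow> x) G \<Longrightarrow> ((\<lambda>n. quad_form q (g n)) \<longlongrightarrow> quad_form q x) G"
  unfolding quad_form_def by (intro tendsto_intros)

lemma second_order_limit:
  fixes x :: "nat \<Rightarrow> real ^ 'n::finite"
  assumes "taylor2 f l q" and "\<And>n. x n \<noteq> 0" and "x \<longlonglongrightarrow> 0"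
    and dir: "(\<lambda>n. x n /\<^sub>R norm (x n)) \<longlonglongrightarrow> \<xi>"
  shows "(\<lambda>n. (f (x n) - lin_form l (x n)) / (norm (x n))\<^sup>2) \<longlonglongrightarrow> quad_form q \<xi>"
proof -
  have "filterlim x (at 0) sequentially"
    using assms by (simp add: filterlim_at)
  then have rem: "(\<lambda>n. (f (x n) - lin_form l (x n) - quad_form q (x n)) / (norm (x n))\<^sup>2) \<longlonglongrightarrow> 0"
    by (rule filterlim_compose[OF taylor2_remainder[OF assms(1)]])
  have "(f (x n) - lin_form l (x n)) / (norm (x n))\<^sup>2
      = (f (x n) - lin_form l (x n) - quad_form q (x n)) / (norm (x n))\<^sup>2
        + quad_form q (x n /\<^sub>R norm (x n))" for n
    by (simp add: quad_form_scaleR diff_divide_distrib power_inverse divide_inverse algebra_simps)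
  with tendsto_add[OF rem tendsto_quad_form[OF dir]] show ?thesis by simp
qed

lemma first_order_limit:
  fixes x :: "nat \<Rightarrow> real ^ 'n::finite"
  assumes "taylor2 f l q" and nz: "\<And>n. x n \<noteq> 0" and "x \<longlonglongrightarrow> 0"
    and dir: "(\<lambda>n. x n /\<^sub>R norm (x n)) \<longlonglongrightarrow> \<xi>"
  shows "(\<lambda>n. f (x n) / norm (x n)) \<longlonglongrightarrow> lin_form l \<xi>"
proof -
  have "f (x n) / norm (x n)
      = norm (x n) * ((f (x n) - lin_form l (x n)) / (norm (x n))\<^sup>2)
        + lin_form l (x n /\<^sub>R norm (x n))" for n
    using nz[of n] by (simp add: lin_form_scaleR power2_eq_square field_simps)
  with tendsto_add[OF tendsto_mult[OF tendsto_norm[OF assms(3)] second_order_limit[OF assms]]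
      tendsto_lin_form[OF dir]]
  show ?thesis by simp
qed

lemma convergent_directions:
  fixes x :: "nat \<Rightarrow> 'a::euclidean_space"
  assumes "\<And>n. x n \<noteq> 0"
  obtains r \<xi> where "strict_mono r" "norm \<xi> = 1"
    "(\<lambda>n. x (r n) /\<^sub>R norm (x (r n))) \<longlonglongrightarrow> \<xi>"
proof -
  have "\<forall>n. x n /\<^sub>R norm (x n) \<in> sphere 0 1"
    using assms by simp
  then obtain \<xi> r where "\<xi> \<in> sphere 0 1" "strict_mono r"
      "((\<lambda>n. x n /\<^sub>R norm (x n)) \<circ> r) \<longlonglongrightarrow> \<xi>"
    by (rule seq_compactE[OF compact_imp_seq_compact[OF compact_sphere]])
  then show thesis
    using that by (simp add: o_def)
qed

section \<open>The criterion\<close>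

lemma lin_dependency_lin_form:
  assumes "lin_dependency l S \<mu>"
  shows "(\<Sum>u\<in>S. \<mu> u * lin_form (l u) x) = 0"
proof -
  have "(\<Sum>u\<in>S. \<mu> u * lin_form (l u) x) = (\<Sum>j\<in>UNIV. (\<Sum>u\<in>S. \<mu> u * l u j) * x $ j)"
    unfolding lin_form_def sum_distrib_left sum_distrib_right
    by (subst sum.swap) (simp add: mult.assoc)
  then show ?thesis using assms by (simp add: lin_dependency_def)
qed

lemma convex_dependency_zero:
  assumes "lin_dependency l S \<mu>" and "finite S" and "\<And>u. u \<in> S \<Longrightarrow> \<mu> u > 0"
    and "\<And>u. u \<in> S \<Longrightarrow> lin_form (l u) \<xi> \<ge> 0" and "u \<in> S"
  shows "lin_form (l u) \<xi> = 0"
proof -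
  have "\<forall>v\<in>S. \<mu> v * lin_form (l v) \<xi> = 0"
    using lin_dependency_lin_form[OF assms(1), of \<xi>] assms(2,3,4)
    by (subst (asm) sum_nonneg_eq_0_iff) (auto intro: mult_nonneg_nonneg less_imp_le)
  then show ?thesis using assms(3,5) by fastforce
qed

text \<open>
  The combination of the \<open>F u\<close> with coefficients \<open>\<mu>\<close> has no linear part at any \<open>x\<^sub>n\<close>, so its quotient by
  \<open>\<parallel>x\<^sub>n\<parallel>\<^sup>2\<close> converges although those of the single \<open>F u\<close> need not.
\<close>

lemma dep_quad_form_nonneg:
  fixes x :: "nat \<Rightarrow> real ^ 'n::finite"
  assumes dep: "lin_dependency l S \<mu>" and "S \<subseteq> {1..m}" and pos: "\<And>u. u \<in> S \<Longrightarrow> \<mu> u > 0"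
    and taylor: "\<And>u. u \<in> S \<Longrightarrow> taylor2 (F u) (l u) (q u)"
    and x: "\<And>n. x n \<noteq> 0" "x \<longlonglongrightarrow> 0" "(\<lambda>n. x n /\<^sub>R norm (x n)) \<longlonglongrightarrow> \<xi>"
    and nonneg: "\<And>u n. u \<in> S \<Longrightarrow> F u (x n) \<ge> 0"
  shows "dep_quad_form m q \<mu> \<xi> \<ge> 0"
proof -
  have "(\<Sum>u\<in>S. \<mu> u * ((F u (x n) - lin_form (l u) (x n)) / (norm (x n))\<^sup>2))
      = (\<Sum>u\<in>S. \<mu> u * F u (x n)) / (norm (x n))\<^sup>2" for n
  proof -
    have "(\<Sum>u\<in>S. \<mu> u * (F u (x n) - lin_form (l u) (x n))) = (\<Sum>u\<in>S. \<mu> u * F u (x n))"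
      using lin_dependency_lin_form[OF dep, of "x n"]
      by (simp add: right_diff_distrib sum_subtractf)
    then show ?thesis by (simp add: sum_divide_distrib[symmetric])
  qed
  moreover have "(\<lambda>n. \<Sum>u\<in>S. \<mu> u * ((F u (x n) - lin_form (l u) (x n)) / (norm (x n))\<^sup>2))
      \<longlonglongrightarrow> (\<Sum>u\<in>S. \<mu> u * quad_form (q u) \<xi>)"
    by (intro tendsto_sum tendsto_mult_left second_order_limit taylor x)
  ultimately have "(\<lambda>n. (\<Sum>u\<in>S. \<mu> u * F u (x n)) / (norm (x n))\<^sup>2)
      \<longlonglongrightarrow> (\<Sum>u\<in>S. \<mu> u * quad_form (q u) \<xi>)"
    by simp
  then have "0 \<le> (\<Sum>u\<in>S. \<mu> u * quad_form (q u) \<xi>)"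
    by (rule LIMSEQ_le_const)
      (auto intro!: divide_nonneg_nonneg sum_nonneg mult_nonneg_nonneg less_imp_le[OF pos] nonneg)
  also have "\<dots> = dep_quad_form m q \<mu> \<xi>"
    unfolding dep_quad_form_def using dep \<open>S \<subseteq> {1..m}\<close>
    by (intro sum.mono_neutral_left) (auto simp: lin_dependency_def)
  finally show ?thesis .
qed

theorem theorem8:
  fixes U :: "(real ^ 'n::finite) set"
    and F :: "nat \<Rightarrow> real ^ 'n \<Rightarrow> real"
    and m L :: nat
    and l :: "nat \<Rightarrow> 'n \<Rightarrow> real"
    and q :: "nat \<Rightarrow> 'n \<Rightarrow> 'n \<Rightarrow> real"
    and S :: "nat \<Rightarrow> nat set"
    and lam :: "nat \<Rightarrow> nat \<Rightarrow> real"
    and X :: "nat \<Rightarrow> 'n set"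
    and Y :: "'n set"
  assumes "open U" and "0 \<in> U"
    and "m \<le> CARD('n)"
    and "\<And>u. u \<in> {1..m} \<Longrightarrow> real_analytic_on (F u) U"
    and "\<And>u. u \<in> {1..m} \<Longrightarrow> F u 0 = 0"
    and "\<And>u. u \<in> {1..m} \<Longrightarrow> taylor2 (F u) (l u) (q u)"
    and "(\<Union>a\<in>{1..L}. S a) = {1..m}" and "disjoint_family_on S {1..L}"
    and A: "\<And>a. a \<in> {1..L} \<Longrightarrow> unique_lin_dependency l (S a) (lam a)"
      "\<And>a u. a \<in> {1..L} \<Longrightarrow> u \<in> S a \<Longrightarrow> lam a u > 0"
    and B: "(\<Union>a\<in>{1..L}. X a) \<union> Y = UNIV" "disjoint_family_on X {1..L}"
      "\<And>a. a \<in> {1..L} \<Longrightarrow> X a \<inter> Y = {}"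
      "\<And>a u j. a \<in> {1..L} \<Longrightarrow> u \<in> S a \<Longrightarrow> j \<notin> X a \<Longrightarrow> l u j = 0"
    and C: "negatively_defined_on (common_kernel m l) L (\<lambda>a. dep_quad_form m q (lam a))"
  shows "strict_local_max (\<lambda>x. Min ((\<lambda>u. F u x) ` {1..m})) U 0"
proof -
  have cover: "\<exists>a\<in>{1..L}. u \<in> S a" if "u \<in> {1..m}" for u
    using that \<open>(\<Union>a\<in>{1..L}. S a) = {1..m}\<close> by blast
  have sub: "S a \<subseteq> {1..m}" if "a \<in> {1..L}" for a
    using that \<open>(\<Union>a\<in>{1..L}. S a) = {1..m}\<close> by blast
  have dep: "lin_dependency l (S a) (lam a)" if "a \<in> {1..L}" for a
    using A(1)[OF that] by (simp add: unique_lin_dependency_def)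
  have no_direction: False
    if x: "\<And>n. x n \<noteq> 0" "x \<longlonglongrightarrow> 0" and nonneg: "\<And>u n. u \<in> {1..m} \<Longrightarrow> F u (x n) \<ge> 0"
    for x :: "nat \<Rightarrow> real ^ 'n"
  proof -
    obtain r \<xi> where r: "strict_mono r" and unit: "norm \<xi> = 1"
      and dir: "(\<lambda>n. x (r n) /\<^sub>R norm (x (r n))) \<longlonglongrightarrow> \<xi>"
      using convergent_directions[of x] x(1) by blast
    have lim: "(\<lambda>n. x (r n)) \<longlonglongrightarrow> 0"
      using LIMSEQ_subseq_LIMSEQ[OF x(2) r] by (simp add: o_def)
    have lin_nonneg: "lin_form (l u) \<xi> \<ge> 0" if u: "u \<in> {1..m}" for u
      by (rule LIMSEQ_le_const[OF first_order_limit[OF assms(6)[OF u] x(1) lim dir]])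
        (auto intro!: divide_nonneg_nonneg nonneg u)
    have "lin_form (l u) \<xi> = 0" if u: "u \<in> {1..m}" for u
    proof -
      obtain a where a: "a \<in> {1..L}" "u \<in> S a" using cover[OF u] by blast
      show ?thesis
        using finite_subset[OF sub[OF a(1)]] A(2)[OF a(1)] lin_nonneg sub[OF a(1)] a(2)
        by (intro convex_dependency_zero[OF dep[OF a(1)]]) auto
    qed
    then have "\<xi> \<in> common_kernel m l"
      by (simp add: common_kernel_def)
    moreover have "dep_quad_form m q (lam a) \<xi> \<ge> 0" if a: "a \<in> {1..L}" for a
      using sub[OF a] nonneg
      by (intro dep_quad_form_nonneg[OF dep[OF a] _ A(2)[OF a] assms(6) x(1) lim dir]) auto
    ultimately have "\<xi> = 0"
      using C by (simp add: negatively_defined_on_def positively_defined_on_def)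
    with unit show False by simp
  qed
  \<comment> \<open>The minimum of an empty family would be an unspecified number. Without any functions there are
    no subfamilies either, and negative definiteness would make every vector zero; formally, any
    sequence of nonzero points tending to the origin then contradicts \<open>no_direction\<close>.\<close>
  have "{1..m} \<noteq> {}"
  proof
    assume "{1..m} = {}"
    moreover obtain e :: "real ^ 'n" where "norm e = 1"
      using vector_choose_size[of 1] by auto
    moreover have "(\<lambda>n. (1 / Suc n) *\<^sub>R e) \<longlonglongrightarrow> 0"
      using tendsto_scaleR[OF LIMSEQ_Suc[OF lim_1_over_n] tendsto_const[of e]] by simp
    ultimately show False
      by (intro no_direction[of "\<lambda>n. (1 / Suc n) *\<^sub>R e"]) auto
  qed
  then have Min_less: "Min ((\<lambda>u. F u x) ` {1..m}) < 0 \<longleftrightarrow> (\<exists>u\<in>{1..m}. F u x < 0)" for x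
    by (subst Min_less_iff) auto
  have "\<forall>\<^sub>F x in at 0 within U. \<exists>u\<in>{1..m}. F u x < 0"
  proof (rule sequentially_imp_eventually_within, intro allI impI, elim conjE)
    fix x :: "nat \<Rightarrow> real ^ 'n"
    assume x: "\<forall>n. x n \<in> U \<and> x n \<noteq> 0" "x \<longlonglongrightarrow> 0"
    show "\<forall>\<^sub>F n in sequentially. \<exists>u\<in>{1..m}. F u (x n) < 0"
    proof (rule ccontr)
      assume "\<not> ?thesis"
      from not_eventually_sequentiallyD[OF this]
      obtain r :: "nat \<Rightarrow> nat"
        where r: "strict_mono r" "\<And>n. \<not> (\<exists>u\<in>{1..m}. F u (x (r n)) < 0)"
        by auto
      have "(x \<circ> r) \<longlonglongrightarrow> 0" using LIMSEQ_subseq_LIMSEQ[OF x(2) r(1)] .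
      then show False
        using x(1) r(2) by (intro no_direction[of "x \<circ> r"]) (auto simp: not_less)
    qed
  qed
  moreover have "(\<lambda>u. F u 0) ` {1..m} = {0}"
    using \<open>{1..m} \<noteq> {}\<close> assms(5) by force
  ultimately show ?thesis
    using \<open>0 \<in> U\<close> by (simp add: strict_local_max_def Min_less del: One_nat_def)
qed

end
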